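(* For every integer $k\ge 1$ the sequence $S^{(1)}_k=\bigl(S^{(1)}(n+k-1,k)\bigr)_{n\ge1}$ of (signless) Stirling numbers of the first kind is not almost realizable.
   Context: For $n\ge 1$ and $0\le k\le n$, $S^{(1)}(n,k)$ denotes the (signless) Stirling number of the first kind: the number of permutations of $\{1,\dots,n\}$ with exactly $k$ cycles (fixed points count as cycles). For $k\ge1$, $S^{(1)}_k$ is the sequence whose $n$-th term ($n\ge1$) is $S^{(1)}(n+k-1,k)$; for example $S^{(1)}_3=(1,6,35,225,\dots)$. For an integer sequence $A=(A_n)_{n\ge1}$ write $(\mu*A)(n)=\sum_{d\mid n}\mu(n/d)A_d$, where $\mu$ is the classical Möbius function. For a rational number $x$, $\mathrm{Denom}(x)$ denotes the (positive) denominator of $x$ written in lowest terms. For a sequence $A$ of non-negative integers define $$\mathrm{Fail}(A)=\mathrm{lcm}\bigl(\{\mathrm{Denom}\bigl(\tfrac1n(\mu*A)(n)\bigr)\mid n\ge1\}\bigr)$$ if this is finite, and $\mathrm{Fail}(A)=\infty$ otherwise. The sequence $A$ is called almost realizable if $\mathrm{Fail}(A)<\infty$ and $A$ satisfies the sign condition $(\mu*A)(n)\ge0$ for all $n\ge1$. *)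

theory Defs
  imports
    "HOL-Combinatorics.Stirling"
    "HOL-Combinatorics.Orbits"
    "HOL-Computational_Algebra.Squarefree"
    "HOL-Library.Extended_Nat"
begin

definition moebius_mu :: "nat \<Rightarrow> int" where
  "moebius_mu n = (if squarefree n then (-1) ^ card (prime_factors n) else 0)"

text \<open>
  Sequences indexed by \<open>n \<ge> 1\<close> are functions on \<^typ>\<open>nat\<close> whose value at \<open>0\<close> is never used:
  the operators below are only evaluated at \<open>n \<ge> 1\<close>, and all divisors of such an \<open>n\<close> are
  positive.
\<close>

definition moebius_conv :: "(nat \<Rightarrow> int) \<Rightarrow> nat \<Rightarrow> int" where
  "moebius_conv A n = (\<Sum>d | d dvd n. moebius_mu (n div d) * A d)"

definition denom :: "rat \<Rightarrow> nat" where
  "denom x = nat (snd (quotient_of x))"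

definition fail_denoms :: "(nat \<Rightarrow> nat) \<Rightarrow> nat set" where
  "fail_denoms A = {denom (of_int (moebius_conv (\<lambda>i. int (A i)) n) / of_nat n) | n. n \<ge> 1}"

text \<open>
  On \<^typ>\<open>nat\<close>, \<^const>\<open>Lcm\<close> of a set of positive numbers is \<open>0\<close> exactly if the set is infinite,
  i.e. if its elements have no positive common multiple.
\<close>

definition fail :: "(nat \<Rightarrow> nat) \<Rightarrow> enat" where
  "fail A = (if Lcm (fail_denoms A) = 0 then \<infinity> else enat (Lcm (fail_denoms A)))"

lemma fail_less_infinity_iff:
  "fail A < \<infinity> \<longleftrightarrow> (\<exists>m>0. \<forall>d\<in>fail_denoms A. d dvd m)"
proof
  assume "fail A < \<infinity>"
  hence "Lcm (fail_denoms A) > 0"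
    by (auto simp: fail_def split: if_splits)
  thus "\<exists>m>0. \<forall>d\<in>fail_denoms A. d dvd m"
    by (intro exI[of _ "Lcm (fail_denoms A)"]) (auto intro: dvd_Lcm)
next
  assume "\<exists>m>0. \<forall>d\<in>fail_denoms A. d dvd m"
  then obtain m where m: "m > 0" "\<And>d. d \<in> fail_denoms A \<Longrightarrow> d dvd m"
    by blast
  hence "Lcm (fail_denoms A) dvd m"
    by (intro Lcm_least)
  with m(1) have "Lcm (fail_denoms A) \<noteq> 0"
    by auto
  thus "fail A < \<infinity>"
    by (simp add: fail_def)
qed

definition almost_realizable :: "(nat \<Rightarrow> nat) \<Rightarrow> bool" where
  "almost_realizable A \<longleftrightarrow>
     fail A < \<infinity> \<and> (\<forall>n\<ge>1. moebius_conv (\<lambda>i. int (A i)) n \<ge> 0)"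

definition stirling1_seq :: "nat \<Rightarrow> nat \<Rightarrow> nat" where
  "stirling1_seq k n = stirling (n + k - 1) k"


text \<open>
  The library defines \<^const>\<open>stirling\<close> by its recurrence. The following shows that
  it counts the permutations with a given number of cycles, i.e. of orbits (fixed points
  included).
\<close>

lemma orbit_transpose_comp:
  assumes "finite A" "a \<notin> A" "p permutes A" "b \<in> A" "x \<in> A"
  defines "q \<equiv> transpose a b \<circ> p"
  shows "orbit q x = (if b \<in> orbit p x then insert a (orbit p x) else orbit p x)"
proof -
  have "q permutes insert a A"
    unfolding q_def using assms
    by (intro permutes_compose permutes_subset[OF \<open>p permutes A\<close>] permutes_swap_id) auto
  hence pq: "permutation q" and pp: "permutation p"
    using assms(1,3) by (auto simp: permutation_permutes)
  have pa: "p a = a"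
    using assms by (simp add: permutes_not_in)
  have qa: "q a = b"
    by (simp add: q_def pa)
  have sub: "orbit p x \<subseteq> A"
    using assms by (intro permutes_orbit_subset)
  have q1: "q y = p y" if "y \<in> A" "p y \<noteq> b" for y
  proof -
    have "p y \<in> A" using that assms(3) by (simp add: permutes_in_image)
    thus ?thesis using that assms(2) by (auto simp: q_def transpose_def)
  qed
  have q2: "q y = a" if "p y = b" for y
    using that by (simp add: q_def)
  let ?S = "if b \<in> orbit p x then insert a (orbit p x) else orbit p x"
  have closed: "q y \<in> ?S" if "y \<in> ?S" for y
  proof (cases "y = a")
    case True
    thus ?thesis using that sub assms(2) qa by (auto split: if_splits)
  next
    case False
    hence y: "y \<in> orbit p x" using that by (auto split: if_splits)
    hence py: "p y \<in> orbit p x" by (rule orbit.step)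
    show ?thesis
      using q1[of y] q2[of y] y py sub by (cases "p y = b") auto
  qed
  have x: "x \<in> orbit p x" "x \<in> orbit q x"
    using pp pq by (auto intro: permutation_self_in_orbit)
  show ?thesis
  proof
    show "orbit q x \<subseteq> ?S"
    proof
      fix y assume "y \<in> orbit q x"
      thus "y \<in> ?S"
      proof induction
        case base
        show ?case using x by (intro closed) auto
      qed (rule closed)
    qed
  next
    have p_step: "p y \<in> orbit q x" if "y \<in> A" "y \<in> orbit q x" for y
    proof (cases "p y = b")
      case True
      hence "q (q y) = p y" using q2[of y] qa by simp
      thus ?thesis using that orbit.step by metis
    next
      case False
      thus ?thesis using q1[of y] that orbit.step by metis
    qed
    have sub2: "orbit p x \<subseteq> orbit q x"
    proof
      fix y assume "y \<in> orbit p x"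
      thus "y \<in> orbit q x"
      proof induction
        case base
        show ?case using p_step x \<open>x \<in> A\<close> by blast
      next
        case (step y)
        thus ?case using p_step sub by blast
      qed
    qed
    have "a \<in> orbit q x" if "b \<in> orbit p x"
    proof -
      have "b \<in> orbit q x" using that sub2 by auto
      hence "orbit q b = orbit q x"
        using x by (meson orbit_swap orbit_trans subset_antisym subsetI)
      moreover have "orbit q b = orbit q a"
        using permutation_orbit_step[OF pq, of a] qa by simp
      ultimately show ?thesis using permutation_self_in_orbit[OF pq, of a] by simp
    qed
    with sub2 show "?S \<subseteq> orbit q x" by auto
  qed
qed

lemma card_orbits_transpose_comp:
  assumes "finite A" "a \<notin> A" "p permutes A" "b \<in> insert a A"
  defines "q \<equiv> transpose a b \<circ> p"
  shows "card (orbit q ` insert a A) =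
           (if b = a then Suc (card (orbit p ` A)) else card (orbit p ` A))"
proof (cases "b = a")
  case True
  hence [simp]: "q = p" by (simp add: q_def)
  have "p a = a" using assms by (simp add: permutes_not_in)
  hence "orbit p a = {a}"
    by (simp add: orbit_eq_singleton_iff)
  moreover have "{a} \<notin> orbit p ` A"
  proof
    assume "{a} \<in> orbit p ` A"
    then obtain x where "x \<in> A" "orbit p x = {a}" by auto
    thus False using permutes_orbit_subset[OF assms(3), of x] assms(2) by auto
  qed
  ultimately show ?thesis using True assms(1) by simp
next
  case False
  hence b: "b \<in> A" using assms by simp
  define f where "f = (\<lambda>S. if b \<in> S then insert a S else S)"
  have f: "orbit q x = f (orbit p x)" if "x \<in> A" for x
    unfolding q_def f_def by (rule orbit_transpose_comp) (use assms b that in auto)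
  have "q permutes insert a A"
    unfolding q_def using assms
    by (intro permutes_compose permutes_subset[OF \<open>p permutes A\<close>] permutes_swap_id) auto
  hence pq: "permutation q"
    using assms(1) by (auto simp: permutation_permutes)
  have "q a = b"
    using assms by (simp add: q_def permutes_not_in)
  hence "orbit q a = orbit q b"
    using permutation_orbit_step[OF pq, of a] by simp
  hence "orbit q ` insert a A = orbit q ` A"
    using b by auto
  also have "\<dots> = f ` (orbit p ` A)"
    using f by (auto simp: image_image)
  also have "card \<dots> = card (orbit p ` A)"
  proof (rule card_image, rule inj_onI)
    fix S T assume "S \<in> orbit p ` A" "T \<in> orbit p ` A" and eq: "f S = f T"
    hence "S \<subseteq> A" "T \<subseteq> A"
      using permutes_orbit_subset[OF assms(3)] by auto
    hence "a \<notin> S" "a \<notin> T" using assms(2) by auto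
    moreover have "f S - {a} = f T - {a}" using eq by simp
    ultimately show "S = T" by (auto simp: f_def split: if_splits)
  qed
  finally show ?thesis using False by simp
qed

lemma card_permutations_eq_stirling:
  assumes "finite A"
  shows "card {p. p permutes A \<and> card (orbit p ` A) = k} = stirling (card A) k"
  using assms
proof (induction A arbitrary: k rule: finite_induct)
  case empty
  show ?case by (cases k) auto
next
  case (insert a A)
  define P where "P = (\<lambda>k. {p. p permutes A \<and> card (orbit p ` A) = k})"
  define g where "g = (\<lambda>(b, p). transpose a b \<circ> p :: 'a \<Rightarrow> 'a)"
  have P: "finite (P k)" "card (P k) = stirling (card A) k" for k
    using insert finite_permutations[of A] by (auto simp: P_def)
  have inj: "inj_on g {(b, p). b \<in> insert a A \<and> p \<in> {p. p permutes A}}"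
  proof (rule inj_onI, clarsimp simp del: insert_iff)
    fix b p c r
    assume *: "b \<in> insert a A" "p permutes A" "c \<in> insert a A" "r permutes A"
      and eq: "g (b, p) = g (c, r)"
    have "p a = a" "r a = a" using * insert.hyps by (auto simp: permutes_not_in)
    hence "b = c" using fun_cong[OF eq, of a] by (simp add: g_def)
    moreover have "transpose a b \<circ> g (b, p) = p" "transpose a c \<circ> g (c, r) = r"
      by (auto simp: g_def fun_eq_iff)
    ultimately show "b = c \<and> p = r" using eq by metis
  qed
  let ?B = "{p. p permutes insert a A \<and> card (orbit p ` insert a A) = k}"
  have all: "{p. p permutes insert a A} = g ` {(b, p). b \<in> insert a A \<and> p \<in> {p. p permutes A}}"
    unfolding g_def by (rule permutes_insert)
  have cardg: "card (orbit (g (b, p)) ` insert a A) =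
      (if b = a then Suc (card (orbit p ` A)) else card (orbit p ` A))"
    if "b \<in> insert a A" "p permutes A" for b p
    unfolding g_def prod.case using insert.hyps that by (intro card_orbits_transpose_comp)
  define X where "X = {a} \<times> {p. p permutes A \<and> Suc (card (orbit p ` A)) = k}"
  define Y where "Y = A \<times> P k"
  have "?B = {q \<in> {p. p permutes insert a A}. card (orbit q ` insert a A) = k}"
    by blast
  also have "\<dots> = g ` {(b, p). b \<in> insert a A \<and> p permutes A \<and>
                        card (orbit (g (b, p)) ` insert a A) = k}"
    unfolding all by blast
  also have "{(b, p). b \<in> insert a A \<and> p permutes A \<and> card (orbit (g (b, p)) ` insert a A) = k}
      = {(b, p). b \<in> insert a A \<and> p permutes A \<and>
           (if b = a then Suc (card (orbit p ` A)) else card (orbit p ` A)) = k}"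
  proof (rule Collect_cong, clarify)
    fix b p
    show "(b \<in> insert a A \<and> p permutes A \<and> card (orbit (g (b, p)) ` insert a A) = k) \<longleftrightarrow>
          (b \<in> insert a A \<and> p permutes A \<and>
           (if b = a then Suc (card (orbit p ` A)) else card (orbit p ` A)) = k)"
      using cardg[of b p] by metis
  qed
  also have "\<dots> = X \<union> Y"
    using insert.hyps by (auto simp: X_def Y_def P_def)
  finally have "card ?B = card (g ` (X \<union> Y))" by simp
  also have "\<dots> = card (X \<union> Y)"
    by (intro card_image inj_on_subset[OF inj]) (auto simp: X_def Y_def P_def)
  also have "\<dots> = card X + card Y"
  proof (rule card_Un_disjoint)
    show "finite X" unfolding X_def
      by (intro finite_cartesian_product finite_subset[OF _ finite_permutations[of A]])
         (use insert.hyps in auto)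
  qed (use insert.hyps P in \<open>auto simp: X_def Y_def\<close>)
  also have "card Y = card A * stirling (card A) k"
    using P by (simp add: Y_def card_cartesian_product)
  also have "card X + \<dots> = stirling (Suc (card A)) k"
  proof (cases k)
    case 0
    thus ?thesis by (cases "card A") (auto simp: X_def)
  next
    case (Suc k')
    hence "card X = card (P k')"
      by (simp add: X_def P_def card_cartesian_product)
    thus ?thesis using Suc P by simp
  qed
  finally show ?case using insert.hyps by simp
qed

corollary stirling_eq_card_permutations:
  "stirling n k = card {p. p permutes {1..n} \<and> card (orbit p ` {1..n}) = k}"
  by (simp add: card_permutations_eq_stirling)

end

theory Submission
  imports Defs "HOL-Computational_Algebra.Polynomial" "HOL-Number_Theory.Residues"
begin

text \<open>
  Modulo a prime \<open>p\<close>, \<open>x (x + 1) \<cdots> (x + p - 1) \<equiv> x^p - x\<close>. Multiplying by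
  \<open>(x + p) \<cdots> (x + p + m - 1) \<equiv> x (x + 1) \<cdots> (x + m - 1)\<close> and comparing coefficients below
  degree \<open>p\<close> gives \<open>stirling (p + m) (j + 1) \<equiv> - stirling m j\<close>. Hence the \<open>p\<close>-th term of the
  sequence is congruent to \<open>- stirling (k - 1) (k - 1) = -1\<close> for every prime \<open>p > k\<close>, while the
  first term is \<open>1\<close>. So \<open>(\<mu> * A)(p) \<equiv> -2\<close>, and every odd prime \<open>p > k\<close> occurs as a
  denominator.
\<close>

text \<open>Lagrange's bound on the number of roots modulo a prime: splitting off the root
  \<open>a\<close> leaves a quotient that vanishes modulo \<open>p\<close> at every other
  \<open>b\<close>, since \<open>p\<close> is prime and does not divide
  \<open>b - a\<close>.\<close>

lemma const_poly_dvd_if_roots_mod: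
  fixes f :: "int poly" and p :: int
  assumes "prime p" "finite A" "degree f < card A"
    and "\<And>a b. a \<in> A \<Longrightarrow> b \<in> A \<Longrightarrow> p dvd a - b \<Longrightarrow> a = b"
    and "\<And>a. a \<in> A \<Longrightarrow> p dvd poly f a"
  shows "[:p:] dvd f"
  using assms(2-)
proof (induction A arbitrary: f rule: finite_induct)
  case empty
  thus ?case by simp
next
  case (insert a A)
  define g where "g = synthetic_div f a"
  have f: "f = [:- a, 1:] * g + [:poly f a:]"
    using synthetic_div_correct'[of a f] by (simp add: g_def)
  have "[:p:] dvd g"
  \<comment> \<open>For constant \<open>f\<close>, the degree of \<open>g\<close> does not drop
    below that of \<open>f\<close>, and \<open>A\<close> may be empty, so the induction hypothesis
    need not apply.\<close>
  proof (cases "degree f = 0")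
    case True
    hence "g = 0" unfolding g_def by (simp only: synthetic_div_eq_0_iff)
    thus ?thesis by simp
  next
    case False
    show ?thesis
    proof (rule insert.IH)
      show "degree g < card A"
        using False insert by (simp add: g_def degree_synthetic_div)
    next
      fix b assume b: "b \<in> A"
      have "p dvd poly f b - poly f a"
        using insert.prems(3) b by (intro dvd_diff) auto
      also have "poly f b - poly f a = (b - a) * poly g b"
        by (subst (1) f) (simp add: algebra_simps)
      finally have "p dvd b - a \<or> p dvd poly g b"
        using \<open>prime p\<close> by (simp add: prime_dvd_mult_iff)
      thus "p dvd poly g b"
        using insert.prems(2)[of b a] insert.hyps b by auto
    qed (use insert.prems in auto)
  qed
  moreover have "[:p:] dvd [:poly f a:]"
    using insert.prems(3)[of a] by (simp add: const_poly_dvd_iff coeff_pCons split: nat.split)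
  ultimately show ?case
    by (subst f) (intro dvd_add dvd_mult)
qed

lemma prime_dvd_power_diff_self:
  fixes p x :: nat
  assumes "prime p"
  shows "int p dvd int x ^ p - int x"
proof (cases "p dvd x")
  case True
  hence "int p dvd int x ^ p"
    using prime_gt_0_nat[OF assms] by (intro dvd_trans[OF _ dvd_power]) auto
  with True show ?thesis by simp
next
  case False
  hence "[int x ^ (p - 1) = 1] (mod int p)"
    using fermat_theorem[OF assms False] by (metis cong_int_iff of_nat_1 of_nat_power)
  hence "int p dvd int x * (int x ^ (p - 1) - 1)"
    by (simp add: cong_iff_dvd_diff)
  also have "int x * (int x ^ (p - 1) - 1) = int x ^ p - int x"
    using prime_gt_0_nat[OF assms] by (cases p) (auto simp: algebra_simps)
  finally show ?thesis .
qed

lemma dvd_pochhammer_self: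
  assumes "x < p"
  shows "int p dvd pochhammer (int x) p"
proof (cases "x = 0")
  case True
  thus ?thesis using assms by (simp add: pochhammer_0_left)
next
  case False
  \<comment> \<open>The factor with index \<open>p - x\<close> is \<open>p\<close> itself; for
    \<open>x = 0\<close> this index would be out of range.\<close>
  have "int x + int (p - x) dvd (\<Prod>i<p. int x + int i)"
    using False assms by (intro dvd_prodI) auto
  thus ?thesis
    using assms by (simp add: pochhammer_prod atLeast0LessThan)
qed

text \<open>The difference \<open>f\<close> of the rising factorial and \<open>x^p - x\<close> has
  degree below \<open>p\<close>, as the leading terms cancel, but vanishes modulo \<open>p\<close>
  at all of \<open>0, ..., p - 1\<close>.\<close>

lemma prime_dvd_stirling:
  assumes p: "prime p" and "j < p"
  shows "int p dvd int (stirling p j) + (if j = 1 then 1 else 0)"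
proof -
  define f :: "int poly"
    where "f = (\<Sum>i\<le>p. Polynomial.monom (int (stirling p i)) i)
           - Polynomial.monom 1 p + Polynomial.monom 1 1"
  have p1: "p > 1" using p by (rule prime_gt_1_nat)
  have coeff: "Polynomial.coeff f i = (if i < p then int (stirling p i) + (if i = 1 then 1 else 0) else 0)" for i
    using p1 by (auto simp: f_def coeff_sum coeff_monom)
  have "degree f \<le> p - 1"
    by (rule degree_le) (auto simp: coeff)
  hence deg: "degree f < p" using p1 by linarith
  have "poly f x = pochhammer x p - (x ^ p - x)" for x
    by (simp add: f_def poly_sum poly_monom flip: stirling_pochhammer)
  hence "int p dvd poly f (int x)" if "x < p" for x
    using dvd_pochhammer_self[OF that] prime_dvd_power_diff_self[OF p, of x]
    by (simp only: dvd_diff)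
  moreover have "a = b" if "a \<in> int ` {..<p}" "b \<in> int ` {..<p}" "int p dvd a - b" for a b
    using that by (auto simp: mod_eq_dvd_iff[symmetric])
  ultimately have "[:int p:] dvd f"
    using p deg by (intro const_poly_dvd_if_roots_mod[where A = "int ` {..<p}"])
      (auto simp: card_image)
  hence "int p dvd Polynomial.coeff f j" by (simp add: const_poly_dvd_iff)
  thus ?thesis using assms by (simp add: coeff)
qed

text \<open>Induction on \<open>m\<close> through the Stirling recurrence takes the place of
  multiplying polynomials.\<close>

lemma prime_dvd_stirling_add:
  assumes "prime p" "Suc j < p"
  shows "int p dvd int (stirling (p + m) (Suc j)) + int (stirling m j)"
  using assms(2)
proof (induction m arbitrary: j)
  case 0
  thus ?case using prime_dvd_stirling[OF assms(1) 0] by (cases j) auto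
next
  case (Suc m)
  have IH: "int p dvd int (stirling (p + m) (Suc j)) + int (stirling m j)"
    using Suc by blast
  show ?case
  proof (cases j)
    case 0
    \<comment> \<open>Here \<open>stirling (p + Suc m) 1\<close> is \<open>fact (p + m)\<close>, and
      \<open>stirling (Suc m) 0\<close> is \<open>0\<close>.\<close>
    have "p dvd fact (p + m)"
      using prime_gt_0_nat[OF assms(1)] by (intro dvd_fact) auto
    hence "int p dvd int (fact (p + m))" by (simp only: int_dvd_int_iff)
    thus ?thesis
      using 0 stirling_Suc_n_1[of "p + m"] by (simp del: stirling.simps(4))
  next
    case (Suc i)
    have "int p dvd int (stirling (p + m) (Suc i)) + int (stirling m i)"
      using Suc.IH[of i] Suc Suc.prems by simp
    \<comment> \<open>This is the sum of the two recurrences, with the factor \<open>p + m\<close>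
      split.\<close>
    with IH have "int p dvd int p * int (stirling (p + m) (Suc j))
        + int m * (int (stirling (p + m) (Suc j)) + int (stirling m j))
        + (int (stirling (p + m) (Suc i)) + int (stirling m i))"
      by (metis dvd_add dvd_mult dvd_triv_left)
    thus ?thesis using Suc by (simp add: algebra_simps)
  qed
qed

lemma moebius_conv_prime:
  assumes "prime p"
  shows "moebius_conv A p = A p - A 1"
proof -
  have "{d. d dvd p} = {1, p}" "p \<noteq> 1"
    using assms by (auto simp: prime_nat_iff)
  moreover have "moebius_mu p = -1" "moebius_mu 1 = 1"
    using assms by (auto simp: moebius_mu_def squarefree_prime prime_factorization_prime)
  ultimately show ?thesis
    using prime_gt_0_nat[OF assms] by (simp add: moebius_conv_def)
qed

lemma denom_of_int_div_of_nat:
  assumes "n > 0" "coprime z (int n)"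
  shows "denom (of_int z / of_nat n) = n"
proof -
  have "of_int z / of_nat n = Fract z (int n)"
    by (simp add: Fract_of_int_quotient)
  thus ?thesis
    using assms by (simp add: denom_def quotient_of_Fract)
qed

theorem theorem6:
  fixes k :: nat
  assumes "k \<ge> 1"
  shows "\<not> almost_realizable (stirling1_seq k)"
proof
  assume "almost_realizable (stirling1_seq k)"
  then obtain m where m: "m > 0" "\<And>d. d \<in> fail_denoms (stirling1_seq k) \<Longrightarrow> d dvd m"
    unfolding almost_realizable_def fail_less_infinity_iff by blast
  \<comment> \<open>\<open>p > k\<close> is for the congruence, \<open>p > 2\<close> rules out
    \<open>p dvd 2\<close>, and \<open>p > m\<close> contradicts \<open>p dvd m\<close>.\<close>
  obtain p where p: "prime p" "p > m + k + 2"
    using bigger_prime by blast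
  define z where "z = moebius_conv (\<lambda>i. int (stirling1_seq k i)) p"
  have z: "z = int (stirling (p + (k - 1)) k) - 1"
    using p assms by (simp add: z_def moebius_conv_prime stirling1_seq_def)
  \<comment> \<open>Since \<open>stirling (k - 1) (k - 1) = 1\<close>, the term at \<open>p\<close>
    is \<open>-1\<close> modulo \<open>p\<close>.\<close>
  have "int p dvd z + 2"
    using prime_dvd_stirling_add[OF p(1), of "k - 1" "k - 1"] p assms
    by (simp add: z add.commute)
  have "\<not> int p dvd z"
  proof
    assume "int p dvd z"
    with \<open>int p dvd z + 2\<close> have "int p dvd 2" by (simp add: dvd_add_right_iff)
    thus False using p(2) by (auto dest: zdvd_imp_le)
  qed
  hence "coprime z (int p)"
    using p(1) by (metis coprime_commute prime_imp_coprime prime_nat_int_transfer)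
  hence "denom (of_int z / of_nat p) = p"
    using p by (intro denom_of_int_div_of_nat) auto
  hence "p \<in> fail_denoms (stirling1_seq k)"
    using p unfolding fail_denoms_def z_def mem_Collect_eq by (intro exI[of _ p]) auto
  hence "p dvd m" by (rule m(2))
  thus False using m(1) p(2) by (auto dest: dvd_imp_le)
qed

end
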